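(* Let $n\ge 2$, let $A_2,\dots,A_n$ be positive real scalars, and let $$H_{\mathrm{sR}}(M)=\frac12\sum_{k=2}^n\frac{M_{1k}^2}{A_k},\qquad M\in\mathfrak{so}(n).$$ The equations of motion $$\frac{d}{dt}M=[dH_{\mathrm{sR}}|_M,M]$$ admit a Lax pair formulation $$\frac{d}{dt}(M+\sigma A)=[dH_{\mathrm{sR}}|_M+\sigma B,\;M+\sigma A],$$ for $\sigma$ an arbitrary parameter, where $A=\operatorname{diag}(0,A_2,\dots,A_n)$ and $B=\operatorname{diag}(0,1,\dots,1)$. That is, a curve $M(t)$ in $\mathfrak{so}(n)$ satisfies the equations of motion if and only if it satisfies the Lax equation for all $\sigma$.
   Context: Here $[X,Y]=XY-YX$ is the matrix commutator. The Lie algebra $\mathfrak{so}(n)$ of skew-symmetric real $n\times n$ matrices is identified with its dual via the pairing $\langle M,\Omega\rangle=\frac12\operatorname{Tr}(M^T\Omega)$, and for a smooth function $f$ on $\mathfrak{so}(n)^*\cong\mathfrak{so}(n)$ the derivative $df|_M$ is regarded as the element of $\mathfrak{so}(n)$ such that $\frac{d}{d\epsilon}\big|_{\epsilon=0}f(M+\epsilon N)=\langle N,df|_M\rangle$ for all $N\in\mathfrak{so}(n)$. Explicitly, writing $$M=\begin{pmatrix}0&-\mu^T\\ \mu&\widehat m\end{pmatrix}$$ with $\mu\in\mathbf{R}^{n-1}$ a column vector and $\widehat m\in\mathfrak{so}(n-1)$, and $\hat A^{-1}=\operatorname{diag}(A_2^{-1},\dots,A_n^{-1})$, one has $$dH_{\mathrm{sR}}|_M=\begin{pmatrix}0&-\mu^T\hat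 A^{-1}\\ \hat A^{-1}\mu&0\end{pmatrix}.$$ The equations of motion above are the Lie–Poisson equations of $H_{\mathrm{sR}}$ on $\mathfrak{so}(n)^*$ for the bracket $\{f,g\}(M)=\langle M,[df|_M,dg|_M]\rangle$. *)

theory Defs
  imports "HOL-Analysis.Analysis"
begin

text \<open>The index set \<open>{1, \<dots>, n}\<close> is a finite linearly ordered type \<open>'n\<close> with \<open>n = CARD('n)\<close>;
  the index 1 is its least element.\<close>

type_synonym 'n sqmat = "((real, 'n) vec, 'n) vec"

definition idx1 :: "'n::{finite,linorder}" where
  "idx1 = Min UNIV"

definition so :: "('n::finite) sqmat set" where
  "so = {M. transpose M = - M}"

definition commutator :: "('n::finite) sqmat \<Rightarrow> 'n sqmat \<Rightarrow> 'n sqmat" where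
  "commutator X Y = X ** Y - Y ** X"

definition pairing :: "('n::finite) sqmat \<Rightarrow> 'n sqmat \<Rightarrow> real" where
  "pairing M \<Omega> = 1/2 * trace (transpose M ** \<Omega>)"

text \<open>\<open>df|\<^sub>M\<close> as an element of \<open>so\<close>. Only the values of \<open>f\<close> on \<open>so\<close> matter when \<open>M \<in> so\<close>;
  the element is unique because the pairing is nondegenerate on \<open>so\<close>.\<close>

definition so_derivative :: "(('n::finite) sqmat \<Rightarrow> real) \<Rightarrow> 'n sqmat \<Rightarrow> 'n sqmat" where
  "so_derivative f M = (THE \<Omega>. \<Omega> \<in> so \<and>
     (\<forall>N\<in>so. ((\<lambda>\<epsilon>. f (M + \<epsilon> *\<^sub>R N)) has_real_derivative pairing N \<Omega>) (at 0)))"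

definition diag :: "('n::finite \<Rightarrow> real) \<Rightarrow> 'n sqmat" where
  "diag d = (\<chi> i j. if i = j then d i else 0)"

text \<open>The scalars \<open>A\<^sub>2, \<dots>, A\<^sub>n\<close> are given by \<open>a\<close>, whose value at \<open>idx1\<close> is never used.\<close>

definition H_sR :: "('n::{finite,linorder} \<Rightarrow> real) \<Rightarrow> 'n sqmat \<Rightarrow> real" where
  "H_sR a M = 1/2 * (\<Sum>k\<in>UNIV - {idx1}. (M $ idx1 $ k)\<^sup>2 / a k)"

definition A_mat :: "('n::{finite,linorder} \<Rightarrow> real) \<Rightarrow> 'n sqmat" where
  "A_mat a = diag (\<lambda>i. if i = idx1 then 0 else a i)"

definition B_mat :: "('n::{finite,linorder}) sqmat" where
  "B_mat = diag (\<lambda>i. if i = idx1 then 0 else 1)"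

end

theory Submission
  imports Defs
begin

text \<open>Expanding in \<open>\<sigma>\<close>, the right-hand side of the Lax equation is
  \<open>[dH, M] + \<sigma> ([dH, A] + [B, M]) + \<sigma>\<^sup>2 [B, A]\<close>. The last bracket vanishes because \<open>A\<close> and \<open>B\<close> are
  diagonal; in the middle term \<open>A\<close> cancels the denominators of \<open>dH\<close>, which leaves
  \<open>[dH, A] = - [B, M]\<close>. So both equations have the same right-hand side.\<close>

lemma so_iff: "M \<in> so \<longleftrightarrow> (\<forall>i j. M $ i $ j = - (M $ j $ i))"
proof -
  have "M \<in> so \<longleftrightarrow> (\<forall>i j. M $ j $ i = - (M $ i $ j))"
    by (simp add: so_def transpose_def vec_eq_iff)
  then show ?thesis by blast
qed

lemma so_diff: "X \<in> so \<Longrightarrow> Y \<in> so \<Longrightarrow> X - Y \<in> so"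
  unfolding so_iff vector_minus_component by (smt (verit))

lemma pairing_eq_sum: "pairing M \<Omega> = 1/2 * (\<Sum>i\<in>UNIV. \<Sum>j\<in>UNIV. M $ i $ j * \<Omega> $ i $ j)"
  unfolding pairing_def trace_def transpose_def matrix_matrix_mult_def
  by (simp, rule sum.swap)

lemma pairing_diff_right: "pairing N (X - Y) = pairing N X - pairing N Y"
  by (simp add: pairing_eq_sum right_diff_distrib sum_subtractf)

text \<open>\<open>pairing N N\<close> is half the sum of the squares of all entries of
  \<open>N\<close>.\<close>

lemma pairing_self_eq_0_iff: "pairing N N = 0 \<longleftrightarrow> N = 0"
  by (simp add: pairing_eq_sum sum_nonneg_eq_0_iff sum_nonneg vec_eq_iff)

text \<open>Justifies the \<open>THE\<close> in \<open>so_derivative\<close>: nondegeneracy of the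
  pairing on \<open>so\<close> makes a representing element unique.\<close>

lemma so_derivative_eqI:
  assumes "\<Omega> \<in> so"
    and "\<And>N. N \<in> so \<Longrightarrow> ((\<lambda>\<epsilon>. f (M + \<epsilon> *\<^sub>R N)) has_real_derivative pairing N \<Omega>) (at 0)"
  shows "so_derivative f M = \<Omega>"
  unfolding so_derivative_def
proof (rule the_equality)
  show "\<Omega> \<in> so \<and> (\<forall>N\<in>so. ((\<lambda>\<epsilon>. f (M + \<epsilon> *\<^sub>R N)) has_real_derivative pairing N \<Omega>) (at 0))"
    using assms by blast
next
  fix \<Omega>'
  assume \<Omega>': "\<Omega>' \<in> so \<and> (\<forall>N\<in>so. ((\<lambda>\<epsilon>. f (M + \<epsilon> *\<^sub>R N)) has_real_derivative pairing N \<Omega>') (at 0))"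
  have "\<Omega>' - \<Omega> \<in> so"
    using \<Omega>' assms(1) by (simp add: so_diff)
  \<comment> \<open>The difference of the two candidates is itself the test direction; both pairings
    are the derivative of \<open>f\<close> along it.\<close>
  then have "pairing (\<Omega>' - \<Omega>) \<Omega>' = pairing (\<Omega>' - \<Omega>) \<Omega>"
    using \<Omega>' assms(2) DERIV_unique by blast
  then have "pairing (\<Omega>' - \<Omega>) (\<Omega>' - \<Omega>) = 0"
    by (simp add: pairing_diff_right)
  then show "\<Omega>' = \<Omega>"
    by (simp add: pairing_self_eq_0_iff)
qed

text \<open>The explicit block matrix for the differential of \<open>H_sR\<close>, with blocks
  \<open>\<mu>\<close> and its transpose scaled by the inverse of the diagonal matrix of the
  \<open>a k\<close>.\<close>

definition dH_sR :: "('n::{finite,linorder} \<Rightarrow> real) \<Rightarrow> 'n sqmat \<Rightarrow> 'n sqmat" where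
  "dH_sR a M = (\<chi> i j. if i = idx1 \<and> j \<noteq> idx1 then M $ i $ j / a j
                        else if i \<noteq> idx1 \<and> j = idx1 then M $ i $ j / a i else 0)"

lemma dH_sR_in_so:
  assumes "M \<in> so"
  shows "dH_sR a M \<in> so"
  unfolding so_iff
proof (intro allI)
  fix i j
  have "M $ i $ j = - (M $ j $ i)"
    using assms unfolding so_iff by blast
  then show "dH_sR a M $ i $ j = - (dH_sR a M $ j $ i)"
    by (auto simp: dH_sR_def)
qed

text \<open>The first row and the first column contribute the same sum, which cancels the factor 1/2
  of the pairing.\<close>

lemma pairing_dH_sR:
  assumes "M \<in> so" "N \<in> so"
  shows "pairing N (dH_sR a M) = (\<Sum>k\<in>UNIV - {idx1}. N $ idx1 $ k * M $ idx1 $ k / a k)"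
proof -
  let ?F = "\<lambda>i j. N $ i $ j * dH_sR a M $ i $ j"
  let ?S = "\<Sum>k\<in>UNIV - {idx1}. N $ idx1 $ k * M $ idx1 $ k / a k"
  have row1: "(\<Sum>j\<in>UNIV. ?F idx1 j) = ?S"
    by (subst sum.remove[where x = idx1]) (auto simp: dH_sR_def intro!: sum.cong)
  have row: "(\<Sum>j\<in>UNIV. ?F i j) = N $ idx1 $ i * M $ idx1 $ i / a i" if "i \<noteq> idx1" for i
  proof -
    have "(\<Sum>j\<in>UNIV. ?F i j) = N $ i $ idx1 * M $ i $ idx1 / a i"
      using that by (subst sum.remove[where x = idx1]) (auto simp: dH_sR_def intro!: sum.neutral)
    moreover have "N $ i $ idx1 = - (N $ idx1 $ i)" "M $ i $ idx1 = - (M $ idx1 $ i)"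
      using assms unfolding so_iff by blast+
    ultimately show ?thesis by simp
  qed
  have "(\<Sum>i\<in>UNIV. \<Sum>j\<in>UNIV. ?F i j) = ?S + ?S"
    by (subst sum.remove[where x = idx1]) (simp_all add: row1 row)
  then show ?thesis by (simp add: pairing_eq_sum)
qed

lemma so_derivative_H_sR:
  assumes "M \<in> so"
  shows "so_derivative (H_sR a) M = dH_sR a M"
proof (rule so_derivative_eqI[OF dH_sR_in_so[OF assms]])
  fix N :: "'a sqmat"
  assume "N \<in> so"
  have "((\<lambda>\<epsilon>. (M $ idx1 $ k + \<epsilon> * N $ idx1 $ k)\<^sup>2 / a k) has_real_derivative
      2 * (N $ idx1 $ k * M $ idx1 $ k / a k)) (at 0)" for k
    \<comment> \<open>As a product with the constant \<open>inverse (a k)\<close>, the quotient is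
      differentiated without a side condition on \<open>a k\<close>.\<close>
    unfolding divide_inverse by (auto intro!: derivative_eq_intros)
  then have "((\<lambda>\<epsilon>. 1/2 * (\<Sum>k\<in>UNIV - {idx1}. (M $ idx1 $ k + \<epsilon> * N $ idx1 $ k)\<^sup>2 / a k))
      has_real_derivative 1/2 * (\<Sum>k\<in>UNIV - {idx1}. 2 * (N $ idx1 $ k * M $ idx1 $ k / a k))) (at 0)"
    by (intro DERIV_cmult DERIV_sum)
  then show "((\<lambda>\<epsilon>. H_sR a (M + \<epsilon> *\<^sub>R N)) has_real_derivative pairing N (dH_sR a M)) (at 0)"
    unfolding pairing_dH_sR[OF assms \<open>N \<in> so\<close>] H_sR_def sum_distrib_left[symmetric]
    by simp
qed

lemma matrix_mult_diag_nth: "(X ** diag d) $ i $ j = X $ i $ j * d j"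
  by (simp add: matrix_matrix_mult_def diag_def if_distrib cong: if_cong)

lemma diag_matrix_mult_nth: "(diag d ** X) $ i $ j = d i * X $ i $ j"
  by (simp add: matrix_matrix_mult_def diag_def if_distrib if_distribR cong: if_cong)

lemma commutator_diag_diag: "commutator (diag d) (diag e) = 0"
  by (simp add: commutator_def vec_eq_iff matrix_mult_diag_nth) (simp add: diag_def)

text \<open>Commuting with a diagonal matrix scales each entry by a difference of diagonal values.
  Both sides have \<open>M $ idx1 $ j\<close> in the first row, \<open>- (M $ i $ idx1)\<close> in
  the first column, and 0 on the diagonal and elsewhere.\<close>

lemma commutator_dH_sR_A_mat:
  assumes "\<And>k. k \<noteq> idx1 \<Longrightarrow> a k \<noteq> 0"
  shows "commutator (dH_sR a M) (A_mat a) = - commutator B_mat M"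
  using assms
  by (auto simp: vec_eq_iff commutator_def A_mat_def B_mat_def matrix_mult_diag_nth
      diag_matrix_mult_nth dH_sR_def)

lemma matrix_add_rdistrib:
  fixes A B :: "'a::semiring_1^'n^'m"
  shows "(A + B) ** C = A ** C + B ** C"
  by (simp add: matrix_matrix_mult_def vec_eq_iff distrib_right sum.distrib)

lemma commutator_add_scaleR:
  "commutator (X + \<sigma> *\<^sub>R B) (Y + \<sigma> *\<^sub>R A)
    = commutator X Y + \<sigma> *\<^sub>R (commutator X A + commutator B Y) + \<sigma>\<^sup>2 *\<^sub>R commutator B A"
  by (simp add: commutator_def matrix_add_ldistrib matrix_add_rdistrib matrix_scalar_ac
      flip: scalar_matrix_assoc) (simp add: algebra_simps power2_eq_square)

lemma commutator_Lax:
  assumes "M \<in> so" "\<And>k. k \<noteq> idx1 \<Longrightarrow> a k \<noteq> 0"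
  shows "commutator (so_derivative (H_sR a) M + \<sigma> *\<^sub>R B_mat) (M + \<sigma> *\<^sub>R A_mat a)
    = commutator (so_derivative (H_sR a) M) M"
proof -
  have "commutator B_mat (A_mat a) = 0"
    by (simp add: A_mat_def B_mat_def commutator_diag_diag)
  with assms show ?thesis
    by (simp add: commutator_add_scaleR so_derivative_H_sR commutator_dH_sR_A_mat)
qed

theorem proposition3p1:
  fixes a :: "'n::{finite,linorder} \<Rightarrow> real"
    and M :: "real \<Rightarrow> 'n sqmat"
    and T :: "real set"
  assumes "CARD('n) \<ge> 2"
    and "\<And>k. k \<noteq> idx1 \<Longrightarrow> a k > 0"
    and "is_interval T" and "interior T \<noteq> {}"
    and "\<And>t. t \<in> T \<Longrightarrow> M t \<in> so"
  shows "(\<forall>t\<in>T. (M has_vector_derivative commutator (so_derivative (H_sR a) (M t)) (M t))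
              (at t within T))
     \<longleftrightarrow>
     (\<forall>\<sigma>::real. \<forall>t\<in>T. ((\<lambda>s. M s + \<sigma> *\<^sub>R A_mat a) has_vector_derivative
        commutator (so_derivative (H_sR a) (M t) + \<sigma> *\<^sub>R B_mat) (M t + \<sigma> *\<^sub>R A_mat a))
              (at t within T))"
proof -
  \<comment> \<open>Applied with the constant \<open>C = \<sigma> *\<^sub>R A_mat a\<close>, so that
    the left-hand sides agree.\<close>
  have shift: "((\<lambda>s. M s + C) has_vector_derivative D) (at t within T)
      \<longleftrightarrow> (M has_vector_derivative D) (at t within T)" for C D t
    by (rule has_vector_derivative_add_const)
  have "commutator (so_derivative (H_sR a) (M t) + \<sigma> *\<^sub>R B_mat) (M t + \<sigma> *\<^sub>R A_mat a)
      = commutator (so_derivative (H_sR a) (M t)) (M t)" if "t \<in> T" for \<sigma> t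
    using that assms(2,5) by (intro commutator_Lax) (auto simp: less_imp_neq[symmetric])
  \<comment> \<open>After rewriting, the Lax equation no longer mentions \<open>\<sigma>\<close>, so
    its quantifier drops out.\<close>
  then show ?thesis by (simp add: shift)
qed

end
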